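(* There exists a real $\theta>\log_2 3$ such that $\pi(\vec T_k,\theta)=1$ for all integers $k\ge 4$.
   Context: A partially directed $k$-graph ($k$-PDG) on a vertex set $V$ specifies for each $k$-subset $S\subseteq V$ exactly one of: no edge on $S$; an undirected edge on $S$; or a directed edge on $S$ directed toward a chosen vertex of $S$. For an $n$-vertex $k$-PDG $\vec H$, $\alpha(\vec H)=e_u(\vec H)/\binom nk$ and $\beta(\vec H)=e_d(\vec H)/\binom nk$ where $e_u,e_d$ count undirected and directed edges. $\vec F$ is a subgraph of $\vec H$ if a $k$-PDG isomorphic to $\vec F$ can be obtained from $\vec H$ by deleting edges, deleting vertices and forgetting directions of edges; $\vec H$ is $\vec F$-free otherwise. $\vec T_k$ is the $k$-PDG on $\{1,\dots,k+1\}$ with undirected edges $\{1,\dots,k\}$, $\{2,\dots,k+1\}$ and the edge $\{1,\dots,k-1,k+1\}$ directed toward $k+1$. $\pi(\vec F,\theta)$ is the smallest real number such that every $n$-vertex $\vec F$-free $k$-PDG $\vec H$ satisfies $\alpha(\vec H)+\theta\beta(\vec H)\le\pi(\vec F,\theta)+o_{n\to\infty}(1)$. *)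

theory Defs
  imports Complex_Main
begin

datatype 'a edge_state = No_Edge | Undirected | Directed 'a

record 'a pdg =
  pverts :: "'a set"
  pstate :: "'a set \<Rightarrow> 'a edge_state"

definition ksubsets :: "nat \<Rightarrow> 'a set \<Rightarrow> 'a set set" where
  "ksubsets k V = {S. S \<subseteq> V \<and> finite S \<and> card S = k}"

text \<open>The state function is total; its value is pinned to \<open>No_Edge\<close> on all sets
  that are not $k$-subsets of the vertex set.\<close>

definition is_kpdg :: "nat \<Rightarrow> 'a pdg \<Rightarrow> bool" where
  "is_kpdg k H \<longleftrightarrow>
     (\<forall>S. S \<notin> ksubsets k (pverts H) \<longrightarrow> pstate H S = No_Edge) \<and>
     (\<forall>S v. pstate H S = Directed v \<longrightarrow> v \<in> S)"

definition undirected_edges :: "nat \<Rightarrow> 'a pdg \<Rightarrow> 'a set set" where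
  "undirected_edges k H = {S \<in> ksubsets k (pverts H). pstate H S = Undirected}"

definition directed_edges :: "nat \<Rightarrow> 'a pdg \<Rightarrow> 'a set set" where
  "directed_edges k H = {S \<in> ksubsets k (pverts H). \<exists>v. pstate H S = Directed v}"

definition pdg_alpha :: "nat \<Rightarrow> 'a pdg \<Rightarrow> real" where
  "pdg_alpha k H = real (card (undirected_edges k H)) / real (card (pverts H) choose k)"

definition pdg_beta :: "nat \<Rightarrow> 'a pdg \<Rightarrow> real" where
  "pdg_beta k H = real (card (directed_edges k H)) / real (card (pverts H) choose k)"

definition pdg_iso :: "nat \<Rightarrow> 'a pdg \<Rightarrow> 'b pdg \<Rightarrow> bool" where
  "pdg_iso k F G \<longleftrightarrow>
     (\<exists>f. bij_betw f (pverts F) (pverts G) \<and>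
          (\<forall>S \<in> ksubsets k (pverts F). pstate G (f ` S) = map_edge_state f (pstate F S)))"

text \<open>\<open>pdg_reduces k H G\<close>: \<open>G\<close> arises from \<open>H\<close> by deleting vertices (together with the
  edges containing them), deleting edges (second disjunct) and forgetting directions
  (third disjunct).\<close>

definition pdg_reduces :: "nat \<Rightarrow> 'a pdg \<Rightarrow> 'a pdg \<Rightarrow> bool" where
  "pdg_reduces k H G \<longleftrightarrow>
     pverts G \<subseteq> pverts H \<and>
     (\<forall>S \<in> ksubsets k (pverts G).
        pstate G S = pstate H S \<or>
        pstate G S = No_Edge \<or>
        (pstate G S = Undirected \<and> (\<exists>v. pstate H S = Directed v)))"

definition pdg_subgraph :: "nat \<Rightarrow> 'a pdg \<Rightarrow> 'b pdg \<Rightarrow> bool" where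
  "pdg_subgraph k F H \<longleftrightarrow> (\<exists>G. is_kpdg k G \<and> pdg_reduces k H G \<and> pdg_iso k F G)"

definition pdg_free :: "nat \<Rightarrow> 'a pdg \<Rightarrow> 'b pdg \<Rightarrow> bool" where
  "pdg_free k F H \<longleftrightarrow> \<not> pdg_subgraph k F H"

text \<open>Every finite $k$-PDG is isomorphic to one whose vertices are natural numbers, so it
  suffices to let \<open>H\<close> range over those. The sequence \<open>\<epsilon>\<close> is the $o(1)$ term.\<close>

definition pdg_pi :: "nat \<Rightarrow> 'a pdg \<Rightarrow> real \<Rightarrow> real" where
  "pdg_pi k F \<theta> = (LEAST x::real. \<exists>\<epsilon>::nat \<Rightarrow> real. \<epsilon> \<longlonglongrightarrow> 0 \<and>
     (\<forall>H::nat pdg. finite (pverts H) \<longrightarrow> is_kpdg k H \<longrightarrow> pdg_free k F H \<longrightarrow>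
        pdg_alpha k H + \<theta> * pdg_beta k H \<le> x + \<epsilon> (card (pverts H))))"

definition T_pdg :: "nat \<Rightarrow> nat pdg" where
  "T_pdg k = \<lparr> pverts = {1..k+1},
     pstate = (\<lambda>S. if S = {1..k} \<or> S = {2..k+1} then Undirected
                   else if S = insert (k+1) {1..k-1} then Directed (k+1)
                   else No_Edge) \<rparr>"

lemma T_pdg_is_kpdg:
  assumes "k \<ge> 2"
  shows "is_kpdg k (T_pdg k)"
proof -
  have "card (insert (k+1) {1..k-1}) = k"
    using assms by (subst card_insert_disjoint) auto
  then show ?thesis
    using assms by (auto simp: is_kpdg_def T_pdg_def ksubsets_def split: if_splits)
qed

end

theory Submission imports Defs begin

text \<open>
  The bound \<open>\<pi>(T\<^sub>k, \<theta>) \<le> 1\<close> holds for every \<open>\<theta> \<le> 1 + 1/\<surd>2\<close>, and \<open>log\<^sub>2 3 < 8/5 < 1 + 1/\<surd>2\<close> because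
  \<open>3\<^sup>5 < 2\<^sup>8\<close> and \<open>9/25 < 1/2\<close>. For \<open>\<theta> = 1 + 1/\<surd>2\<close> it says that the density of non-edges is
  asymptotically at least \<open>\<beta>/\<surd>2\<close>. For a $(k-1)$-set \<open>R\<close> let \<open>h\<^sub>R\<close> be the number of
  \<open>c\<close> such that \<open>R \<union> {c}\<close> is directed toward \<open>c\<close>, let
  \<open>n\<^sub>R\<close> be the number of \<open>c\<close> such that \<open>R \<union> {c}\<close> is not an edge, and expand
  \<open>0 \<le> \<Sum>\<^sub>R (t h\<^sub>R - n\<^sub>R)\<^sup>2\<close> with \<open>t = k/\<surd>2 - 1\<close>. The diagonal terms are of lower order and the others
  are grouped by the $(k+1)$-set \<open>W = R \<union> {c, c'}\<close>. Freeness implies that either every directed edge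
  \<open>W - {c}\<close> points at some \<open>a\<close> for which \<open>W - {a}\<close> is not an edge, or \<open>W\<close> contains exactly two
  edges. In both cases the contribution of \<open>W\<close> is at most \<open>2k (m - d/\<surd>2)\<close>, where \<open>m\<close> and \<open>d\<close> count
  the non-edges and the directed edges in \<open>W\<close>; the second case is the one that needs \<open>k \<ge> 4\<close> and
  the constant \<open>1/\<surd>2\<close>. Summing over \<open>W\<close> bounds the non-edges from below.
  The complete undirected \<open>k\<close>-graph shows that \<open>\<pi>(T\<^sub>k, \<theta>) \<ge> 1\<close>.
\<close>

section \<open>Double counting over subsets of fixed size\<close>

lemma finite_ksubsets: "finite V \<Longrightarrow> finite (ksubsets k V)"
  by (rule finite_subset[of _ "Pow V"]) (auto simp: ksubsets_def)

lemma card_ksubsets: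
  assumes "finite V"
  shows "card (ksubsets k V) = card V choose k"
proof -
  have "ksubsets k V = {S. S \<subseteq> V \<and> card S = k}"
    using assms by (auto simp: ksubsets_def intro: finite_subset)
  then show ?thesis using n_subsets[OF assms] by simp
qed

lemma ksubsets_eq_facets:
  assumes "finite W" "card W = Suc k"
  shows "ksubsets k W = (\<lambda>c. W - {c}) ` W"
proof (intro equalityI subsetI)
  fix S assume S: "S \<in> ksubsets k W"
  then have "card (W - S) = 1"
    using assms by (auto simp: ksubsets_def card_Diff_subset)
  then obtain c where "W - S = {c}" by (auto simp: card_1_singleton_iff)
  then have "c \<in> W" "S = W - {c}" using S by (auto simp: ksubsets_def)
  then show "S \<in> (\<lambda>c. W - {c}) ` W" by blast
qed (use assms in \<open>auto simp: ksubsets_def\<close>)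

lemma image_ksubsets:
  assumes "inj_on f V" "f ` V \<subseteq> X" "S \<in> ksubsets k V"
  shows "f ` S \<in> ksubsets k X"
proof -
  have "inj_on f S" using assms by (auto simp: ksubsets_def intro: inj_on_subset)
  then show ?thesis using assms by (auto simp: ksubsets_def card_image)
qed

lemma sum_ksubsets_insert:
  fixes \<phi> :: "'a set \<Rightarrow> 'a \<Rightarrow> 'b::comm_monoid_add"
  assumes "finite V"
  shows "(\<Sum>R\<in>ksubsets j V. \<Sum>c\<in>V - R. \<phi> (insert c R) c) = (\<Sum>S\<in>ksubsets (Suc j) V. \<Sum>c\<in>S. \<phi> S c)"
proof -
  have "(\<Sum>R\<in>ksubsets j V. \<Sum>c\<in>V - R. \<phi> (insert c R) c)
      = (\<Sum>(R, c)\<in>(SIGMA R:ksubsets j V. V - R). \<phi> (insert c R) c)"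
    using assms finite_ksubsets by (subst sum.Sigma) auto
  also have "\<dots> = (\<Sum>(S, c)\<in>(SIGMA S:ksubsets (Suc j) V. S). \<phi> S c)"
    by (rule sum.reindex_bij_witness[where
          i = "\<lambda>(S, c). (S - {c}, c)" and j = "\<lambda>(R, c). (insert c R, c)"])
      (auto simp: ksubsets_def insert_absorb)
  also have "\<dots> = (\<Sum>S\<in>ksubsets (Suc j) V. \<Sum>c\<in>S. \<phi> S c)"
    using assms finite_ksubsets by (subst sum.Sigma) (auto simp: ksubsets_def)
  finally show ?thesis .
qed

lemma sum_ksubsets_insert2:
  fixes \<phi> :: "'a set \<Rightarrow> 'a \<Rightarrow> 'a \<Rightarrow> 'b::comm_monoid_add"
  assumes "finite V"
  shows "(\<Sum>R\<in>ksubsets j V. \<Sum>c\<in>V - R. \<Sum>c'\<in>V - R - {c}. \<phi> (insert c' (insert c R)) c c')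
    = (\<Sum>W\<in>ksubsets (Suc (Suc j)) V. \<Sum>c\<in>W. \<Sum>c'\<in>W - {c}. \<phi> W c c')"
proof -
  define \<psi> where "\<psi> S c = (\<Sum>c'\<in>V - S. \<phi> (insert c' S) c c')" for S c
  have "(\<Sum>R\<in>ksubsets j V. \<Sum>c\<in>V - R. \<Sum>c'\<in>V - R - {c}. \<phi> (insert c' (insert c R)) c c')
      = (\<Sum>R\<in>ksubsets j V. \<Sum>c\<in>V - R. \<psi> (insert c R) c)"
    by (simp add: \<psi>_def Diff_insert[symmetric])
  also have "\<dots> = (\<Sum>S\<in>ksubsets (Suc j) V. \<Sum>c\<in>S. \<psi> S c)"
    by (rule sum_ksubsets_insert[OF assms])
  also have "\<dots> = (\<Sum>S\<in>ksubsets (Suc j) V. \<Sum>c'\<in>V - S. \<Sum>c\<in>insert c' S - {c'}. \<phi> (insert c' S) c c')"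
    unfolding \<psi>_def by (intro sum.cong[OF refl] trans[OF sum.swap]) (auto intro!: sum.cong)
  also have "\<dots> = (\<Sum>W\<in>ksubsets (Suc (Suc j)) V. \<Sum>c'\<in>W. \<Sum>c\<in>W - {c'}. \<phi> W c c')"
    by (rule sum_ksubsets_insert[OF assms])
  also have "\<dots> = (\<Sum>W\<in>ksubsets (Suc (Suc j)) V. \<Sum>c\<in>W. \<Sum>c'\<in>W - {c}. \<phi> W c c')"
  proof (rule sum.cong[OF refl])
    fix W assume "W \<in> ksubsets (Suc (Suc j)) V"
    then have fin: "finite W" by (simp add: ksubsets_def)
    have "(\<Sum>c'\<in>W. \<Sum>c\<in>W - {c'}. \<phi> W c c') = (\<Sum>c'\<in>W. \<Sum>c\<in>{c\<in>W. c \<noteq> c'}. \<phi> W c c')"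
      by (intro sum.cong) auto
    also have "\<dots> = (\<Sum>c\<in>W. \<Sum>c'\<in>{c'\<in>W. c \<noteq> c'}. \<phi> W c c')"
      by (rule sum.swap_restrict[OF fin fin])
    also have "\<dots> = (\<Sum>c\<in>W. \<Sum>c'\<in>W - {c}. \<phi> W c c')" by (intro sum.cong) auto
    finally show "(\<Sum>c'\<in>W. \<Sum>c\<in>W - {c'}. \<phi> W c c') = (\<Sum>c\<in>W. \<Sum>c'\<in>W - {c}. \<phi> W c c')" .
  qed
  finally show ?thesis .
qed

lemma sum_square_eq_diag_plus_offdiag:
  fixes f :: "'a \<Rightarrow> 'b::comm_semiring_1"
  assumes "finite A"
  shows "(\<Sum>a\<in>A. f a)\<^sup>2 = (\<Sum>a\<in>A. (f a)\<^sup>2) + (\<Sum>a\<in>A. \<Sum>b\<in>A - {a}. f a * f b)"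
proof -
  have "(\<Sum>a\<in>A. f a)\<^sup>2 = (\<Sum>a\<in>A. \<Sum>b\<in>A. f a * f b)"
    by (simp add: power2_eq_square sum_product)
  also have "\<dots> = (\<Sum>a\<in>A. (f a)\<^sup>2 + (\<Sum>b\<in>A - {a}. f a * f b))"
    using assms by (intro sum.cong) (auto simp: sum.remove power2_eq_square)
  finally show ?thesis by (simp add: sum.distrib)
qed

lemma sum_square_ksubsets:
  fixes g :: "'a set \<Rightarrow> 'a \<Rightarrow> 'b::comm_semiring_1"
  assumes "finite V"
  shows "(\<Sum>R\<in>ksubsets j V. (\<Sum>c\<in>V - R. g (insert c R) c)\<^sup>2) =
    (\<Sum>S\<in>ksubsets (Suc j) V. \<Sum>c\<in>S. (g S c)\<^sup>2) +
    (\<Sum>W\<in>ksubsets (Suc (Suc j)) V. \<Sum>c\<in>W. \<Sum>c'\<in>W - {c}. g (W - {c}) c' * g (W - {c'}) c)"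
proof -
  have "(\<Sum>R\<in>ksubsets j V. \<Sum>c\<in>V - R. \<Sum>c'\<in>V - R - {c}. g (insert c R) c * g (insert c' R) c')
      = (\<Sum>R\<in>ksubsets j V. \<Sum>c\<in>V - R. \<Sum>c'\<in>V - R - {c}.
          g (insert c' (insert c R) - {c}) c' * g (insert c' (insert c R) - {c'}) c)"
  proof (intro sum.cong refl)
    fix R c c' assume "c \<in> V - R" "c' \<in> V - R - {c}"
    then have "insert c' (insert c R) - {c} = insert c' R" "insert c' (insert c R) - {c'} = insert c R"
      by auto
    then show "g (insert c R) c * g (insert c' R) c'
        = g (insert c' (insert c R) - {c}) c' * g (insert c' (insert c R) - {c'}) c"
      by (simp add: mult.commute)
  qed
  also have "\<dots> = (\<Sum>W\<in>ksubsets (Suc (Suc j)) V. \<Sum>c\<in>W. \<Sum>c'\<in>W - {c}.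
      g (W - {c}) c' * g (W - {c'}) c)"
    by (rule sum_ksubsets_insert2[OF assms])
  moreover have "(\<Sum>R\<in>ksubsets j V. \<Sum>c\<in>V - R. (g (insert c R) c)\<^sup>2)
      = (\<Sum>S\<in>ksubsets (Suc j) V. \<Sum>c\<in>S. (g S c)\<^sup>2)"
    by (rule sum_ksubsets_insert[OF assms])
  ultimately show ?thesis
    using assms by (simp add: sum_square_eq_diag_plus_offdiag sum.distrib)
qed

lemma sum_card_facets:
  assumes "finite V" and E: "E \<subseteq> ksubsets k V"
  shows "(\<Sum>W\<in>ksubsets (Suc k) V. card {c\<in>W. W - {c} \<in> E}) = (card V - k) * card E"
proof -
  have "(\<Sum>W\<in>ksubsets (Suc k) V. card {c\<in>W. W - {c} \<in> E})
      = (\<Sum>W\<in>ksubsets (Suc k) V. \<Sum>c\<in>W. of_bool (W - {c} \<in> E))"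
    by (intro sum.cong) (auto simp: ksubsets_def Int_def)
  also have "\<dots> = (\<Sum>S\<in>ksubsets k V. \<Sum>c\<in>V - S. of_bool (insert c S - {c} \<in> E))"
    by (rule sum_ksubsets_insert[OF assms(1), symmetric])
  also have "\<dots> = (\<Sum>S\<in>ksubsets k V. (card V - k) * of_bool (S \<in> E))"
  proof (rule sum.cong[OF refl])
    fix S assume "S \<in> ksubsets k V"
    then have "card (V - S) = card V - k" by (auto simp: ksubsets_def card_Diff_subset)
    moreover have "(\<Sum>c\<in>V - S. of_bool (insert c S - {c} \<in> E)) = (\<Sum>c\<in>V - S. of_bool (S \<in> E) :: nat)"
      by (intro sum.cong) auto
    ultimately show "(\<Sum>c\<in>V - S. of_bool (insert c S - {c} \<in> E)) = (card V - k) * of_bool (S \<in> E)"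
      by simp
  qed
  also have "\<dots> = (card V - k) * card E"
    using E finite_ksubsets[OF assms(1), of k]
    by (simp add: sum_distrib_left[symmetric] Int_absorb1 del: sum_mult_of_bool_eq)
  finally show ?thesis .
qed

section \<open>Subgraphs as embeddings\<close>

definition weakens :: "'a edge_state \<Rightarrow> 'a edge_state \<Rightarrow> bool" where
  "weakens s s' \<longleftrightarrow> s = s' \<or> s = No_Edge \<or> s = Undirected \<and> (\<exists>v. s' = Directed v)"

definition pdg_embedding :: "nat \<Rightarrow> ('a \<Rightarrow> 'b) \<Rightarrow> 'a pdg \<Rightarrow> 'b pdg \<Rightarrow> bool" where
  "pdg_embedding k f F H \<longleftrightarrow> inj_on f (pverts F) \<and> f ` pverts F \<subseteq> pverts H \<and>
     (\<forall>S\<in>ksubsets k (pverts F). weakens (map_edge_state f (pstate F S)) (pstate H (f ` S)))"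

lemma pdg_subgraph_imp_embedding:
  assumes "pdg_subgraph k F H"
  shows "\<exists>f. pdg_embedding k f F H"
proof -
  obtain G f where red: "pdg_reduces k H G"
    and f: "bij_betw f (pverts F) (pverts G)"
    and state: "\<And>S. S \<in> ksubsets k (pverts F) \<Longrightarrow> pstate G (f ` S) = map_edge_state f (pstate F S)"
    using assms unfolding pdg_subgraph_def pdg_iso_def by blast
  have inj: "inj_on f (pverts F)" and image: "f ` pverts F = pverts G"
    using f by (auto simp: bij_betw_def)
  have "f ` pverts F \<subseteq> pverts H" using red image by (simp add: pdg_reduces_def)
  moreover have "weakens (map_edge_state f (pstate F S)) (pstate H (f ` S))"
    if S: "S \<in> ksubsets k (pverts F)" for S
  proof -
    have "f ` S \<in> ksubsets k (pverts G)"
      using inj image S by (intro image_ksubsets) auto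
    then show ?thesis
      using red unfolding pdg_reduces_def weakens_def state[OF S, symmetric] by blast
  qed
  ultimately show ?thesis using inj unfolding pdg_embedding_def by blast
qed

lemma pdg_embedding_imp_subgraph:
  assumes F: "is_kpdg k F" and f: "pdg_embedding k f F H"
  shows "pdg_subgraph k F H"
proof -
  have inj: "inj_on f (pverts F)" and image: "f ` pverts F \<subseteq> pverts H"
    and weak: "\<And>S. S \<in> ksubsets k (pverts F) \<Longrightarrow>
      weakens (map_edge_state f (pstate F S)) (pstate H (f ` S))"
    using f by (auto simp: pdg_embedding_def)
  define g where "g = inv_into (pverts F) f"
  define G where "G = \<lparr>pverts = f ` pverts F, pstate = (\<lambda>S. if S \<in> ksubsets k (f ` pverts F)
      then map_edge_state f (pstate F (g ` S)) else No_Edge)\<rparr>"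
  have preimage: "g ` S \<in> ksubsets k (pverts F)" "f ` g ` S = S" if "S \<in> ksubsets k (f ` pverts F)" for S
  proof -
    show "g ` S \<in> ksubsets k (pverts F)"
      unfolding g_def
      by (rule image_ksubsets[OF inj_on_inv_into[OF subset_refl] _ that]) (auto intro: inv_into_into)
    show "f ` g ` S = S" using that by (simp add: g_def ksubsets_def image_inv_into_cancel)
  qed
  have "v \<in> S" if v: "pstate G S = Directed v" for S v
  proof -
    have S: "S \<in> ksubsets k (f ` pverts F)" and "map_edge_state f (pstate F (g ` S)) = Directed v"
      using v by (auto simp: G_def split: if_splits)
    then obtain u where "pstate F (g ` S) = Directed u" "v = f u"
      by (cases "pstate F (g ` S)") auto
    then show "v \<in> S" using F preimage(2)[OF S] by (auto simp: is_kpdg_def)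
  qed
  then have "is_kpdg k G" by (simp add: is_kpdg_def G_def)
  moreover have "pdg_reduces k H G"
    using image weak[OF preimage(1)] preimage(2) by (force simp: pdg_reduces_def G_def weakens_def)
  moreover have "pdg_iso k F G"
    unfolding pdg_iso_def
  proof (intro exI conjI ballI)
    show "bij_betw f (pverts F) (pverts G)" using inj by (simp add: bij_betw_def G_def)
    fix S assume S: "S \<in> ksubsets k (pverts F)"
    then have "f ` S \<in> ksubsets k (f ` pverts F)" using inj by (intro image_ksubsets) auto
    moreover have "g ` f ` S = S" using S inj by (simp add: g_def ksubsets_def inv_into_image_cancel)
    ultimately show "pstate G (f ` S) = map_edge_state f (pstate F S)" by (simp add: G_def)
  qed
  ultimately show ?thesis unfolding pdg_subgraph_def by blast
qed

lemma pdg_free_if_no_directed_edges: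
  assumes "directed_edges k F \<noteq> {}" "directed_edges k H = {}"
  shows "pdg_free k F H"
  unfolding pdg_free_def
proof
  assume "pdg_subgraph k F H"
  then obtain f where f: "pdg_embedding k f F H" using pdg_subgraph_imp_embedding by blast
  obtain S v where S: "S \<in> ksubsets k (pverts F)" "pstate F S = Directed v"
    using assms(1) by (auto simp: directed_edges_def)
  then have "pstate H (f ` S) = Directed (f v)"
    using f by (auto simp: pdg_embedding_def weakens_def)
  moreover have "f ` S \<in> ksubsets k (pverts H)"
    using f S(1) by (auto simp: pdg_embedding_def intro: image_ksubsets)
  ultimately have "f ` S \<in> directed_edges k H" by (simp add: directed_edges_def)
  then show False using assms(2) by simp
qed

lemma pverts_T_pdg: "pverts (T_pdg k) = {1..k+1}"
  by (simp add: T_pdg_def)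

lemma pstate_T_pdg_facet:
  assumes "k \<ge> 2" "j \<in> {1..k+1}"
  shows "pstate (T_pdg k) ({1..k+1} - {j}) =
    (if j = 1 \<or> j = k+1 then Undirected else if j = k then Directed (k+1) else No_Edge)"
proof -
  have facets: "{1..k} = {1..k+1} - {k+1}" "{2..k+1} = {1..k+1} - {1}"
    "insert (k+1) {1..k-1} = {1..k+1} - {k}" using assms(1) by auto
  have "{1..k+1} - {j} = {1..k+1} - {i} \<longleftrightarrow> j = i" if "i \<in> {1..k+1}" for i
    using assms(2) that by blast
  then show ?thesis
    unfolding T_pdg_def facets using assms(1) by simp
qed

lemma directed_edges_T_pdg_nonempty:
  assumes "k \<ge> 2"
  shows "directed_edges k (T_pdg k) \<noteq> {}"
proof -
  have "{1..k+1} - {k} \<in> ksubsets k {1..k+1}" using assms by (auto simp: ksubsets_def)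
  moreover have "pstate (T_pdg k) ({1..k+1} - {k}) = Directed (k+1)"
    using assms by (subst pstate_T_pdg_facet) auto
  ultimately show ?thesis by (auto simp: directed_edges_def pverts_T_pdg)
qed

lemma ex_bij_betw_extending:
  assumes fin: "finite A" "finite B" and card: "card A = card B"
    and g: "A' \<subseteq> A" "inj_on g A'" "g ` A' \<subseteq> B"
  obtains f where "bij_betw f A B" "\<And>x. x \<in> A' \<Longrightarrow> f x = g x"
proof -
  have "finite A'" using fin(1) g(1) by (rule rev_finite_subset)
  then have "card (A - A') = card (B - g ` A')"
    using g card by (simp add: card_Diff_subset card_image)
  then obtain h where h: "bij_betw h (A - A') (B - g ` A')"
    using fin by (meson finite_Diff finite_same_card_bij)
  define f where "f x = (if x \<in> A' then g x else h x)" for x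
  have "bij_betw f A' (g ` A')"
    using g(2) by (simp add: f_def bij_betw_def inj_on_def)
  moreover have "bij_betw f (A - A') (B - g ` A')"
    using h by (rule bij_betw_cong[THEN iffD1, rotated]) (simp add: f_def)
  ultimately have "bij_betw f (A' \<union> (A - A')) (g ` A' \<union> (B - g ` A'))"
    by (rule bij_betw_combine) auto
  then have "bij_betw f A B" using g by (simp add: Un_absorb1)
  then show thesis by (rule that) (simp add: f_def)
qed

lemma T_pdg_subgraphI:
  assumes W: "W \<in> ksubsets (Suc k) (pverts H)" and k: "k \<ge> 2"
    and abc: "a \<in> W" "b \<in> W" "c \<in> W" "a \<noteq> b" "a \<noteq> c" "b \<noteq> c"
    and dir: "pstate H (W - {c}) = Directed a"
    and edges: "pstate H (W - {a}) \<noteq> No_Edge" "pstate H (W - {b}) \<noteq> No_Edge"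
  shows "pdg_subgraph k (T_pdg k) H"
proof -
  have W_props: "finite W" "card W = Suc k" "W \<subseteq> pverts H"
    using W by (auto simp: ksubsets_def)
  define g where "g = (\<lambda>_. a)(1 := b, k := c)"
  have g: "g (k+1) = a" "g 1 = b" "g k = c" using k by (auto simp: g_def)
  obtain f where f: "bij_betw f {1..k+1} W" and fg: "\<And>j. j \<in> {1, k, k+1} \<Longrightarrow> f j = g j"
  proof (rule ex_bij_betw_extending[of "{1..k+1}" W "{1, k, k+1}" g])
    show "inj_on g {1, k, k+1}" "g ` {1, k, k+1} \<subseteq> W" using g abc by auto
  qed (use W_props k in auto)
  have f_vals: "f (k+1) = a" "f 1 = b" "f k = c" using fg g by simp_all
  have "pdg_embedding k f (T_pdg k) H"
    unfolding pdg_embedding_def pverts_T_pdg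
  proof (intro conjI ballI)
    show "inj_on f {1..k+1}" "f ` {1..k+1} \<subseteq> pverts H"
      using f W_props(3) by (auto simp: bij_betw_def)
    fix S assume "S \<in> ksubsets k {1..k+1}"
    then obtain j where j: "j \<in> {1..k+1}" and S: "S = {1..k+1} - {j}"
      using ksubsets_eq_facets[of "{1..k+1}" k] by auto
    have "f ` S = W - {f j}"
      using f j unfolding S bij_betw_def by (simp add: inj_on_image_set_diff[of f "{1..k+1}"])
    moreover have "weakens Undirected (pstate H (W - {x}))" if "x = a \<or> x = b" for x
      using edges that by (cases "pstate H (W - {x})") (auto simp: weakens_def)
    ultimately show "weakens (map_edge_state f (pstate (T_pdg k) S)) (pstate H (f ` S))"
      using pstate_T_pdg_facet[OF k j] f_vals dir unfolding S by (auto simp: weakens_def)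
  qed
  then show ?thesis by (rule pdg_embedding_imp_subgraph[OF T_pdg_is_kpdg[OF k]])
qed

section \<open>Configurations on $k+1$ vertices\<close>

definition flag_weight :: "real \<Rightarrow> 'a edge_state \<Rightarrow> 'a \<Rightarrow> real" where
  "flag_weight t s c = t * of_bool (s = Directed c) - of_bool (s = No_Edge)"

text \<open>Here \<open>s c\<close> stands for the state of the facet \<open>W - {c}\<close>.\<close>

locale facet_states =
  fixes W :: "'a set" and s :: "'a \<Rightarrow> 'a edge_state"
  assumes finite_W: "finite W"
    and head_mem: "\<And>c a. c \<in> W \<Longrightarrow> s c = Directed a \<Longrightarrow> a \<in> W - {c}"
begin

definition missing :: "'a set" where
  "missing = {c\<in>W. s c = No_Edge}"

definition directed :: "'a set" where
  "directed = {c\<in>W. \<exists>a. s c = Directed a}"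

definition directed_to_missing :: "'a set" where
  "directed_to_missing = {c\<in>W. \<exists>a\<in>missing. s c = Directed a}"

definition reciprocal :: "'a set" where
  "reciprocal = {c\<in>W. \<exists>a\<in>W. s c = Directed a \<and> s a = Directed c}"

definition flag_form :: "real \<Rightarrow> real" where
  "flag_form t = (\<Sum>c\<in>W. \<Sum>c'\<in>W - {c}. flag_weight t (s c) c' * flag_weight t (s c') c)"

lemma facet_classes_subset:
  "missing \<subseteq> W" "directed \<subseteq> W" "directed_to_missing \<subseteq> directed" "reciprocal \<subseteq> directed"
  by (auto simp: missing_def directed_def directed_to_missing_def reciprocal_def)

lemma finite_facet_classes: "finite missing" "finite directed"
  using facet_classes_subset finite_W by (auto intro: finite_subset)

lemma card_missing_plus_directed: "card missing + card directed \<le> card W"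
proof -
  have "card missing + card directed = card (missing \<union> directed)"
    by (rule card_Un_disjoint[symmetric, OF finite_facet_classes])
      (auto simp: missing_def directed_def)
  also have "\<dots> \<le> card W" using facet_classes_subset by (intro card_mono[OF finite_W]) auto
  finally show ?thesis .
qed

lemma sum_flag_weight_row:
  assumes c: "c \<in> W"
  shows "(\<Sum>c'\<in>W - {c}. flag_weight t (s c) c' * flag_weight t (s c') c) =
    t\<^sup>2 * of_bool (c \<in> reciprocal) - t * of_bool (c \<in> directed_to_missing)
    + of_bool (c \<in> missing) * (real (card missing) - 1 - t * real (card {c'\<in>W. s c' = Directed c}))"
proof (cases "s c")
  case No_Edge
  have heads: "(W - {c}) \<inter> {c'. s c' = Directed c} = {c'\<in>W. s c' = Directed c}"
    using head_mem by blast
  have others: "(W - {c}) \<inter> {c'. s c' = No_Edge} = missing - {c}" by (auto simp: missing_def)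
  have c_missing: "c \<in> missing" using c No_Edge by (simp add: missing_def)
  have card_others: "real (card (missing - {c})) = real (card missing) - 1"
    using card_Suc_Diff1[OF finite_facet_classes(1) c_missing] by linarith
  have fin: "finite (W - {c})" using finite_W by simp
  have "(\<Sum>c'\<in>W - {c}. flag_weight t (s c') c)
      = t * real (card {c'\<in>W. s c' = Directed c}) - (real (card missing) - 1)"
    unfolding flag_weight_def sum_subtractf sum_distrib_left[symmetric]
    by (simp only: sum_of_bool_eq fin heads others card_others)
  then show ?thesis
    using No_Edge c_missing
    by (simp add: flag_weight_def[of t No_Edge] sum_negf reciprocal_def directed_to_missing_def)
next
  case Undirected
  then show ?thesis
    by (simp add: flag_weight_def[of t Undirected] reciprocal_def directed_to_missing_def missing_def)
next
  case (Directed a)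
  have a: "a \<in> W - {c}" using head_mem[OF c Directed] .
  have "(\<Sum>c'\<in>W - {c}. flag_weight t (s c) c' * flag_weight t (s c') c)
      = (\<Sum>c'\<in>W - {c}. if c' = a then t * flag_weight t (s c') c else 0)"
    using Directed by (intro sum.cong) (auto simp: flag_weight_def)
  also have "\<dots> = t * flag_weight t (s a) c" using finite_W a by simp
  finally show ?thesis
    using Directed c a
    by (simp add: flag_weight_def reciprocal_def directed_to_missing_def missing_def power2_eq_square
        right_diff_distrib)
qed

lemma sum_in_degree_missing:
  "(\<Sum>c\<in>missing. card {c'\<in>W. s c' = Directed c}) = card directed_to_missing"
proof -
  have "directed_to_missing = (\<Union>c\<in>missing. {c'\<in>W. s c' = Directed c})"
    by (auto simp: directed_to_missing_def)
  then show ?thesis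
    using finite_W finite_facet_classes(1) by (simp add: card_UN_disjoint disjoint_iff)
qed

lemma flag_form_eq:
  "flag_form t = t\<^sup>2 * real (card reciprocal) - 2 * t * real (card directed_to_missing)
    + real (card missing) * (real (card missing) - 1)"
proof -
  define m where "m = real (card missing)"
  have card_sum: "(\<Sum>c\<in>W. of_bool (c \<in> X)) = real (card X)" if "X \<subseteq> W" for X
    using that finite_W by (simp add: Int_absorb1)
  have subsets: "directed_to_missing \<subseteq> W" "reciprocal \<subseteq> W"
    using facet_classes_subset by auto
  have "(\<Sum>c\<in>W. of_bool (c \<in> missing) * (m - 1 - t * real (card {c'\<in>W. s c' = Directed c})))
      = (\<Sum>c\<in>missing. m - 1 - t * real (card {c'\<in>W. s c' = Directed c}))"
    using facet_classes_subset(1) finite_W by (simp add: Int_absorb1)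
  also have "\<dots> = m * (m - 1) - t * real (card directed_to_missing)"
    unfolding sum_in_degree_missing[symmetric]
    by (simp add: sum_subtractf sum_distrib_left m_def)
  finally show ?thesis
    unfolding flag_form_def m_def
    using card_sum[OF subsets(1)] card_sum[OF subsets(2)]
    by (simp add: sum_flag_weight_row sum.distrib sum_subtractf sum_distrib_left[symmetric]
        del: sum_of_bool_eq sum_mult_of_bool_eq sum_of_bool_mult_eq)
qed

lemma flag_form_le_if_heads_missing:
  assumes heads: "directed_to_missing = directed"
  shows "flag_form t + 2 * (t + 1) * real (card directed) \<le> 2 * (real (card W) - 1) * real (card missing)"
proof -
  define m d w where "m = real (card missing)" and "d = real (card directed)" and "w = real (card W)"
  have "reciprocal = {}"
    using heads by (force simp: reciprocal_def directed_to_missing_def directed_def missing_def)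
  then have form: "flag_form t = m * (m - 1) - 2 * t * d"
    using heads by (simp add: flag_form_eq m_def d_def)
  have m_plus_d: "m + d \<le> w" using card_missing_plus_directed by (simp add: m_def d_def w_def)
  have "2 * d + m * (m - 1) \<le> 2 * (w - 1) * m"
  proof (cases "missing = {}")
    case True
    then have "directed = {}" using heads by (auto simp: directed_to_missing_def)
    then show ?thesis using True by (simp add: d_def m_def)
  next
    case False
    then have "m \<ge> 1" using finite_facet_classes by (simp add: m_def Suc_le_eq card_gt_0_iff)
    moreover have "d \<ge> 0" by (simp add: d_def)
    ultimately have "(m - 1) * (2 * w - m) \<ge> 0" using m_plus_d by (intro mult_nonneg_nonneg) auto
    then show ?thesis using m_plus_d by (simp add: algebra_simps)
  qed
  then show ?thesis unfolding form d_def[symmetric] m_def[symmetric] w_def[symmetric]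
    by (simp add: algebra_simps)
qed

lemma flag_form_le_if_two_edges:
  assumes ac: "a \<in> W" "c \<in> W" "a \<noteq> c" and missing: "missing = W - {a, c}"
    and W: "card W \<ge> 5" and t: "t \<ge> 0" "2 * (t + 1)\<^sup>2 \<le> (real (card W) - 1)\<^sup>2"
  shows "flag_form t + 2 * (t + 1) * real (card directed) \<le> 2 * (real (card W) - 1) * real (card missing)"
proof -
  define k p q d where "k = real (card W) - 1" and "p = real (card reciprocal)"
    and "q = real (card directed_to_missing)" and "d = real (card directed)"
  have k: "k \<ge> 4" using W by (simp add: k_def)
  have "card missing = card W - 2" using ac finite_W by (simp add: missing card_Diff_subset)
  then have m: "real (card missing) = k - 1" using W by (simp add: k_def)
  have "card reciprocal \<le> card directed"
    by (rule card_mono[OF finite_facet_classes(2) facet_classes_subset(4)])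
  moreover have "d \<le> 2" using card_missing_plus_directed m by (simp add: d_def k_def)
  ultimately have "p \<le> 2" by (simp add: p_def d_def)
  have "flag_form t + 2 * (t + 1) * d = t\<^sup>2 * p - 2 * t * q + (k - 1) * (k - 2) + 2 * (t + 1) * d"
    by (simp add: flag_form_eq m p_def q_def)
  also have "\<dots> \<le> t\<^sup>2 * 2 - 0 + (k - 1) * (k - 2) + 2 * (t + 1) * 2"
    using t(1) \<open>p \<le> 2\<close> \<open>d \<le> 2\<close>
    by (intro add_mono diff_mono mult_left_mono order_refl) (auto simp: q_def)
  also have "\<dots> = 2 * (t + 1)\<^sup>2 + 2 + (k - 1) * (k - 2)"
    by (simp add: power2_eq_square algebra_simps)
  also have "\<dots> \<le> k\<^sup>2 + 2 + (k - 1) * (k - 2)" using t(2) by (simp add: k_def)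
  also have "\<dots> \<le> 2 * k * (k - 1)" using k by (simp add: power2_eq_square algebra_simps)
  finally show ?thesis unfolding m d_def k_def .
qed

lemma flag_form_le:
  assumes free: "\<And>a b c. a \<in> W \<Longrightarrow> b \<in> W \<Longrightarrow> c \<in> W \<Longrightarrow> a \<noteq> b \<Longrightarrow> a \<noteq> c \<Longrightarrow> b \<noteq> c \<Longrightarrow>
      s c = Directed a \<Longrightarrow> s a \<noteq> No_Edge \<Longrightarrow> s b = No_Edge"
    and W: "card W \<ge> 5" and t: "t \<ge> 0" "2 * (t + 1)\<^sup>2 \<le> (real (card W) - 1)\<^sup>2"
  shows "flag_form t + 2 * (t + 1) * real (card directed) \<le> 2 * (real (card W) - 1) * real (card missing)"
proof (cases "directed_to_missing = directed")
  case True
  then show ?thesis by (rule flag_form_le_if_heads_missing)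
next
  case False
  then obtain a c where c: "c \<in> W" "s c = Directed a" and "a \<notin> missing"
    by (auto simp: directed_def directed_to_missing_def)
  then have a: "a \<in> W" "a \<noteq> c" "s a \<noteq> No_Edge" using head_mem[OF c] by (auto simp: missing_def)
  have "missing = W - {a, c}"
    using free[of a _ c] a c by (auto simp: missing_def)
  then show ?thesis by (rule flag_form_le_if_two_edges[OF a(1) c(1) a(2) _ W t])
qed

end

section \<open>Non-edges versus directed edges\<close>

definition non_edges :: "nat \<Rightarrow> 'a pdg \<Rightarrow> 'a set set" where
  "non_edges k H = {S \<in> ksubsets k (pverts H). pstate H S = No_Edge}"

lemma card_edge_classes:
  assumes "finite (pverts H)"
  shows "card (non_edges k H) + card (directed_edges k H) + card (undirected_edges k H)
    = card (pverts H) choose k"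
proof -
  let ?N = "non_edges k H" and ?D = "directed_edges k H" and ?U = "undirected_edges k H"
  note defs = non_edges_def directed_edges_def undirected_edges_def
  have "ksubsets k (pverts H) = (?N \<union> ?D) \<union> ?U"
    by (auto simp: defs) (metis edge_state.exhaust)
  moreover have "?N \<inter> ?D = {}" "(?N \<union> ?D) \<inter> ?U = {}" by (auto simp: defs)
  moreover have "finite ?N" "finite ?D" "finite ?U"
    using finite_ksubsets[OF assms] by (auto simp: defs)
  ultimately have "card (ksubsets k (pverts H)) = card ?N + card ?D + card ?U"
    by (simp add: card_Un_disjoint)
  then show ?thesis using card_ksubsets[OF assms] by simp
qed

lemma facet_states_is_kpdg:
  assumes "is_kpdg k H" "finite W"
  shows "facet_states W (\<lambda>c. pstate H (W - {c}))"
  using assms by unfold_locales (auto simp: is_kpdg_def)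

lemma T_pdg_free_facet_bound:
  assumes H: "is_kpdg k H" and free: "pdg_free k (T_pdg k) H" and k: "k \<ge> 4"
    and t: "t \<ge> 0" "2 * (t + 1)\<^sup>2 \<le> (real k)\<^sup>2" and W: "W \<in> ksubsets (Suc k) (pverts H)"
  shows "facet_states.flag_form W (\<lambda>c. pstate H (W - {c})) t
      + 2 * (t + 1) * real (card {c\<in>W. W - {c} \<in> directed_edges k H})
      \<le> 2 * real k * real (card {c\<in>W. W - {c} \<in> non_edges k H})"
proof -
  have W_props: "finite W" "card W = Suc k" "W \<subseteq> pverts H" using W by (auto simp: ksubsets_def)
  interpret facet_states W "\<lambda>c. pstate H (W - {c})"
    by (rule facet_states_is_kpdg[OF H W_props(1)])
  have "W - {c} \<in> ksubsets k (pverts H)" if "c \<in> W" for c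
    using that W_props by (auto simp: ksubsets_def)
  then have "directed = {c\<in>W. W - {c} \<in> directed_edges k H}"
    "missing = {c\<in>W. W - {c} \<in> non_edges k H}"
    by (auto simp: directed_def missing_def directed_edges_def non_edges_def)
  moreover have "flag_form t + 2 * (t + 1) * real (card directed)
      \<le> 2 * (real (card W) - 1) * real (card missing)"
  proof (rule flag_form_le)
    fix a b c assume "a \<in> W" "b \<in> W" "c \<in> W" "a \<noteq> b" "a \<noteq> c" "b \<noteq> c"
      "pstate H (W - {c}) = Directed a" "pstate H (W - {a}) \<noteq> No_Edge"
    then show "pstate H (W - {b}) = No_Edge"
      using T_pdg_subgraphI[OF W, of a b c] k free by (auto simp: pdg_free_def)
  qed (use W_props k t in auto)
  ultimately show ?thesis using W_props(2) by simp
qed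

lemma sum_flag_weight_square_le:
  assumes "finite V" and t: "\<bar>t\<bar> \<le> real k" and k: "k \<ge> 1"
  shows "(\<Sum>S\<in>ksubsets k V. \<Sum>c\<in>S. (flag_weight t (s S) c)\<^sup>2)
    \<le> real (card V choose k) * real k ^ 3"
proof -
  have "\<bar>flag_weight t (s S) c\<bar> \<le> \<bar>real k\<bar>" for S c
    using t k by (auto simp: flag_weight_def)
  then have "(flag_weight t (s S) c)\<^sup>2 \<le> (real k)\<^sup>2" for S c
    by (simp only: abs_le_square_iff)
  then have "(\<Sum>c\<in>S. (flag_weight t (s S) c)\<^sup>2) \<le> real k ^ 3" if "S \<in> ksubsets k V" for S
    using that sum_bounded_above[of S "\<lambda>c. (flag_weight t (s S) c)\<^sup>2" "(real k)\<^sup>2"]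
    by (auto simp: ksubsets_def power3_eq_cube power2_eq_square mult.assoc)
  then show ?thesis
    unfolding card_ksubsets[OF assms(1), symmetric] by (rule sum_bounded_above)
qed

lemma sum_flag_form_ge:
  assumes fin: "finite (pverts H)" and H: "is_kpdg k H" and t: "\<bar>t\<bar> \<le> real k" and k: "k \<ge> 1"
  shows "- (real (card (pverts H) choose k) * real k ^ 3)
    \<le> (\<Sum>W\<in>ksubsets (Suc k) (pverts H). facet_states.flag_form W (\<lambda>c. pstate H (W - {c})) t)"
proof -
  define V where "V = pverts H"
  define g where "g S = flag_weight t (pstate H S)" for S
  have finV: "finite V" using fin by (simp add: V_def)
  have "facet_states.flag_form W (\<lambda>c. pstate H (W - {c})) t
      = (\<Sum>c\<in>W. \<Sum>c'\<in>W - {c}. g (W - {c}) c' * g (W - {c'}) c)" if "W \<in> ksubsets (Suc k) V" for W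
    using that facet_states.flag_form_def[OF facet_states_is_kpdg[OF H]]
    by (simp add: g_def ksubsets_def)
  then have "(\<Sum>S\<in>ksubsets k V. \<Sum>c\<in>S. (g S c)\<^sup>2)
      + (\<Sum>W\<in>ksubsets (Suc k) V. facet_states.flag_form W (\<lambda>c. pstate H (W - {c})) t)
      = (\<Sum>R\<in>ksubsets (k - 1) V. (\<Sum>c\<in>V - R. g (insert c R) c)\<^sup>2)"
    using sum_square_ksubsets[OF finV, of g "k - 1"] k by simp
  also have "\<dots> \<ge> 0" by (intro sum_nonneg) auto
  finally show ?thesis
    using sum_flag_weight_square_le[OF finV t k, of "pstate H"] unfolding g_def V_def by linarith
qed

lemma T_pdg_free_directed_edges_bound:
  assumes fin: "finite (pverts H)" and H: "is_kpdg k H" and free: "pdg_free k (T_pdg k) H"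
    and k: "k \<ge> 4" and t: "t \<ge> 0" "2 * (t + 1)\<^sup>2 \<le> (real k)\<^sup>2"
  shows "2 * (t + 1) * real ((card (pverts H) - k) * card (directed_edges k H))
    \<le> 2 * real k * real ((card (pverts H) - k) * card (non_edges k H))
      + real (card (pverts H) choose k) * real k ^ 3"
proof -
  define V D N where "V = pverts H" and "D = directed_edges k H" and "N = non_edges k H"
  define L where "L W = facet_states.flag_form W (\<lambda>c. pstate H (W - {c})) t" for W
  have "(t + 1)\<^sup>2 \<le> (real k)\<^sup>2" using t(2) zero_le_power2[of "t + 1"] by linarith
  then have "\<bar>t\<bar> \<le> real k" using t(1) by (simp add: abs_le_square_iff[symmetric])
  then have sum_L: "- (real (card V choose k) * real k ^ 3) \<le> (\<Sum>W\<in>ksubsets (Suc k) V. L W)"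
    using sum_flag_form_ge[OF fin H] k by (simp add: L_def V_def)
  have "(\<Sum>W\<in>ksubsets (Suc k) V. L W + 2 * (t + 1) * real (card {c\<in>W. W - {c} \<in> D}))
      \<le> (\<Sum>W\<in>ksubsets (Suc k) V. 2 * real k * real (card {c\<in>W. W - {c} \<in> N}))"
    unfolding L_def D_def N_def V_def
    by (intro sum_mono T_pdg_free_facet_bound[OF H free k t])
  moreover have "(\<Sum>W\<in>ksubsets (Suc k) V. real (card {c\<in>W. W - {c} \<in> E})) = real ((card V - k) * card E)"
    if "E \<subseteq> ksubsets k V" for E
    using sum_card_facets[OF _ that] fin by (simp add: V_def of_nat_sum[symmetric] del: of_nat_sum)
  moreover have "D \<subseteq> ksubsets k V" "N \<subseteq> ksubsets k V"
    by (auto simp: D_def N_def V_def directed_edges_def non_edges_def)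
  ultimately have "(\<Sum>W\<in>ksubsets (Suc k) V. L W) + 2 * (t + 1) * real ((card V - k) * card D)
      \<le> 2 * real k * real ((card V - k) * card N)"
    by (simp only: sum.distrib sum_distrib_left[symmetric])
  then show ?thesis using sum_L unfolding D_def N_def V_def by linarith
qed

section \<open>Densities\<close>

lemma pdg_beta_nonneg: "0 \<le> pdg_beta k H"
  by (simp add: pdg_beta_def)

lemma pdg_alpha_plus_beta_le_1:
  assumes "finite (pverts H)"
  shows "pdg_alpha k H + pdg_beta k H \<le> 1"
  using card_edge_classes[OF assms, of k]
  by (cases "card (pverts H) choose k = 0")
    (auto simp: pdg_alpha_def pdg_beta_def add_divide_distrib[symmetric] divide_le_eq_1)

lemma T_pdg_free_density_bound:
  assumes fin: "finite (pverts H)" and H: "is_kpdg k H" and free: "pdg_free k (T_pdg k) H"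
    and k: "k \<ge> 4" and n: "card (pverts H) > k"
  shows "pdg_alpha k H + (1 + 1 / sqrt 2) * pdg_beta k H
    \<le> 1 + (real k)\<^sup>2 / (2 * real (card (pverts H) - k))"
proof -
  define N D U where "N = real (card (non_edges k H))" and "D = real (card (directed_edges k H))"
    and "U = real (card (undirected_edges k H))"
  define C \<nu> where "C = real (card (pverts H) choose k)" and "\<nu> = real (card (pverts H) - k)"
  have \<nu>: "\<nu> > 0" and C: "C > 0" using n by (simp_all add: \<nu>_def C_def)
  define t where "t = real k / sqrt 2 - 1"
  have "sqrt 2 \<le> real k" using k real_sqrt_le_mono[of 2 4] by simp
  then have t: "t \<ge> 0" "2 * (t + 1)\<^sup>2 \<le> (real k)\<^sup>2" by (simp_all add: t_def power_divide)
  have "2 * (real k / sqrt 2) * (\<nu> * D) \<le> 2 * real k * (\<nu> * N) + C * real k ^ 3"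
    using T_pdg_free_directed_edges_bound[OF fin H free k t]
    by (simp add: t_def N_def D_def C_def \<nu>_def)
  moreover have "2 * (real k / sqrt 2) * (\<nu> * D) = real k * (2 * \<nu>) * (D / sqrt 2)" by simp
  moreover have "2 * real k * (\<nu> * N) + C * real k ^ 3
      = real k * (2 * \<nu>) * (N + C * (real k)\<^sup>2 / (2 * \<nu>))"
    using \<nu> by (simp add: field_simps power2_eq_square power3_eq_cube)
  ultimately have "real k * (2 * \<nu>) * (D / sqrt 2)
      \<le> real k * (2 * \<nu>) * (N + C * (real k)\<^sup>2 / (2 * \<nu>))" by (simp only:)
  then have "D / sqrt 2 \<le> N + C * (real k)\<^sup>2 / (2 * \<nu>)"
    by (rule mult_left_le_imp_le) (use k \<nu> in simp)
  moreover have "N + D + U = C"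
    unfolding N_def D_def U_def C_def using card_edge_classes[OF fin, of k] by linarith
  ultimately have "U + (1 + 1 / sqrt 2) * D \<le> C * (1 + (real k)\<^sup>2 / (2 * \<nu>))"
    by (simp add: algebra_simps)
  then have "(U + (1 + 1 / sqrt 2) * D) / C \<le> 1 + (real k)\<^sup>2 / (2 * \<nu>)"
    using C by (simp add: divide_le_eq mult.commute)
  then show ?thesis
    by (simp add: pdg_alpha_def pdg_beta_def U_def D_def C_def \<nu>_def add_divide_distrib)
qed

definition asymptotic_density_bound :: "nat \<Rightarrow> 'a pdg \<Rightarrow> real \<Rightarrow> real \<Rightarrow> bool" where
  "asymptotic_density_bound k F \<theta> x \<longleftrightarrow> (\<exists>\<epsilon>::nat \<Rightarrow> real. \<epsilon> \<longlonglongrightarrow> 0 \<and>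
     (\<forall>H::nat pdg. finite (pverts H) \<longrightarrow> is_kpdg k H \<longrightarrow> pdg_free k F H \<longrightarrow>
        pdg_alpha k H + \<theta> * pdg_beta k H \<le> x + \<epsilon> (card (pverts H))))"

lemma T_pdg_asymptotic_density_bound:
  assumes k: "k \<ge> 4" and \<theta>: "\<theta> \<le> 1 + 1 / sqrt 2"
  shows "asymptotic_density_bound k (T_pdg k) \<theta> 1"
  unfolding asymptotic_density_bound_def
proof (intro exI conjI allI impI)
  define \<epsilon> where "\<epsilon> n = (if n > k then (real k)\<^sup>2 / (2 * real (n - k)) else 1)" for n
  have "(\<lambda>n. (real k)\<^sup>2 / 2 * inverse (real (Suc n))) \<longlonglongrightarrow> (real k)\<^sup>2 / 2 * 0"
    by (intro tendsto_mult tendsto_const LIMSEQ_inverse_real_of_nat)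
  then have "(\<lambda>n. \<epsilon> (n + Suc k)) \<longlonglongrightarrow> 0"
    by (simp add: \<epsilon>_def field_simps)
  then show "\<epsilon> \<longlonglongrightarrow> 0" by (rule LIMSEQ_offset)
  fix H :: "nat pdg"
  assume H: "finite (pverts H)" "is_kpdg k H" "pdg_free k (T_pdg k) H"
  have "pdg_alpha k H + \<theta> * pdg_beta k H \<le> pdg_alpha k H + (1 + 1 / sqrt 2) * pdg_beta k H"
    using mult_right_mono[OF \<theta> pdg_beta_nonneg] by simp
  also have "\<dots> \<le> 1 + \<epsilon> (card (pverts H))"
  proof (cases "card (pverts H) > k")
    case True
    then show ?thesis using T_pdg_free_density_bound[OF H k] by (simp add: \<epsilon>_def)
  next
    case False
    have "1 / sqrt 2 * pdg_beta k H \<le> 1 * pdg_beta k H"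
      by (intro mult_right_mono pdg_beta_nonneg) simp
    moreover have "0 \<le> pdg_alpha k H" by (simp add: pdg_alpha_def)
    ultimately show ?thesis
      using False pdg_alpha_plus_beta_le_1[OF H(1), of k] by (simp add: \<epsilon>_def algebra_simps)
  qed
  finally show "pdg_alpha k H + \<theta> * pdg_beta k H \<le> 1 + \<epsilon> (card (pverts H))" .
qed

definition complete_pdg :: "nat \<Rightarrow> 'a set \<Rightarrow> 'a pdg" where
  "complete_pdg k V =
    \<lparr>pverts = V, pstate = (\<lambda>S. if S \<in> ksubsets k V then Undirected else No_Edge)\<rparr>"

lemma is_kpdg_complete_pdg: "is_kpdg k (complete_pdg k V)"
  by (auto simp: is_kpdg_def complete_pdg_def)

lemma directed_edges_complete_pdg: "directed_edges k (complete_pdg k V) = {}"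
  by (auto simp: directed_edges_def complete_pdg_def)

lemma pdg_alpha_complete_pdg:
  assumes "finite V" "card V \<ge> k"
  shows "pdg_alpha k (complete_pdg k V) = 1"
proof -
  have "undirected_edges k (complete_pdg k V) = ksubsets k V"
    by (auto simp: undirected_edges_def complete_pdg_def)
  then show ?thesis
    using assms by (simp add: pdg_alpha_def card_ksubsets complete_pdg_def)
qed

lemma asymptotic_density_bound_ge_1:
  assumes F: "directed_edges k F \<noteq> {}" and x: "asymptotic_density_bound k F \<theta> x"
  shows "1 \<le> x"
proof -
  obtain \<epsilon> :: "nat \<Rightarrow> real" where lim: "\<epsilon> \<longlonglongrightarrow> 0"
    and le: "\<And>H::nat pdg. finite (pverts H) \<Longrightarrow> is_kpdg k H \<Longrightarrow> pdg_free k F H \<Longrightarrow>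
        pdg_alpha k H + \<theta> * pdg_beta k H \<le> x + \<epsilon> (card (pverts H))"
    using x unfolding asymptotic_density_bound_def by blast
  have "1 \<le> x + \<epsilon> n" if "n \<ge> k" for n
  proof -
    let ?K = "complete_pdg k {..<n}"
    have "pdg_free k F ?K"
      by (rule pdg_free_if_no_directed_edges[OF F directed_edges_complete_pdg])
    then have "pdg_alpha k ?K + \<theta> * pdg_beta k ?K \<le> x + \<epsilon> n"
      using le[of ?K] is_kpdg_complete_pdg[of k "{..<n}"] by (simp add: complete_pdg_def)
    moreover have "pdg_alpha k ?K = 1" using that by (intro pdg_alpha_complete_pdg) auto
    moreover have "pdg_beta k ?K = 0" by (simp add: pdg_beta_def directed_edges_complete_pdg)
    ultimately show ?thesis by simp
  qed
  moreover have "(\<lambda>n. x + \<epsilon> n) \<longlonglongrightarrow> x + 0" using lim by (intro tendsto_intros)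
  ultimately show "1 \<le> x" using LIMSEQ_le_const[of "\<lambda>n. x + \<epsilon> n" x 1] by auto
qed

lemma pdg_pi_T_pdg:
  assumes "k \<ge> 4" "\<theta> \<le> 1 + 1 / sqrt 2"
  shows "pdg_pi k (T_pdg k) \<theta> = 1"
  unfolding pdg_pi_def asymptotic_density_bound_def[symmetric]
proof (rule Least_equality)
  show "asymptotic_density_bound k (T_pdg k) \<theta> 1"
    by (rule T_pdg_asymptotic_density_bound[OF assms])
  show "1 \<le> x" if "asymptotic_density_bound k (T_pdg k) \<theta> x" for x
    using directed_edges_T_pdg_nonempty that assms(1) by (intro asymptotic_density_bound_ge_1) auto
qed

theorem theorem2p6:
  "\<exists>\<theta>::real. \<theta> > log 2 3 \<and> (\<forall>k::nat. k \<ge> 4 \<longrightarrow> pdg_pi k (T_pdg k) \<theta> = 1)"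
proof (intro exI conjI allI impI)
  have "5 * log 2 3 = log 2 (3 ^ 5 :: real)" by (subst log_nat_power) auto
  also have "\<dots> < log 2 (2 ^ 8)" by (subst log_less_cancel_iff) auto
  also have "\<dots> = 8" by (subst log_nat_power) auto
  finally show "log 2 3 < (8 / 5 :: real)" by simp
  have "sqrt 2 \<le> 5 / 3" by (rule real_le_lsqrt) (simp_all add: power2_eq_square)
  then have "(8 / 5 :: real) \<le> 1 + 1 / sqrt 2" by (simp add: field_simps)
  then show "pdg_pi k (T_pdg k) (8 / 5) = 1" if "k \<ge> 4" for k
    using that by (intro pdg_pi_T_pdg)
qed

end
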